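(* Let $R$ be a commutative ring with unity, $Y\subseteq\mathrm{Spec}(R)$ and $I$ an ideal of $R$. Then the following are equivalent: (a) For every finite subset $F$ of $I$ and every $S\subseteq R$, $h_Y(F)=h_Y(S)$ implies $S\subseteq I$. (b) For every finite subset $F$ of $I$ and every finite subset $G$ of $R$, $h_Y(F)=h_Y(G)$ implies $G\subseteq I$. (c) For every finite subset $F$ of $I$ and every finite subset $G$ of $R$, $h_Y(F)\subseteq h_Y(G)$ implies $G\subseteq I$. (d) For every $a\in R$, $h_Y(a)\in\mathcal{H}_Y(I)$ implies $a\in I$. (e) For every finite subset $F$ of $R$, $h_Y(F)\in\mathcal{H}_Y(I)$ implies $F\subseteq I$. (f) For every finite subset $F$ of $I$ and $a\in R$, $h_Y(F)=h_Y(a)$ implies $a\in I$. (g) For every finite subset $F$ of $I$ and $a\in R$, $h_Y(F)\subseteq h_Y(a)$ implies $a\in I$. (k) For every finite subset $F\subseteq I$, $kh_Y(F)\subseteq I$. (l) For every finite subset $F$ of $I$ and $a\in R$, $kh_Y(a)=kh_Y(F)$ implies $a\in I$. (m) For every finite subset $F$ of $I$ and $a\in R$, $kh_Y(a)\subseteq kh_Y(F)$ implies $a\in I$. (n) For every finite subset $F$ of $I$ and any $S\subseteq R$, $kh_Y(S)=kh_Y(F)$ implies $S\subseteq I$. (o) For every finite subset $F$ of $I$ and any $S\subseteq R$, $kh_Y(S)\subseteq kh_Y(F)$ implies $S\subseteq I$.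
   Context: $h_Y(S)=\{P\in Y: S\subseteq P\}$ for $S\subseteq R$, $h_Y(a)=h_Y(\{a\})$, and for $X\subseteq Y$, $k(X)=\bigcap_{P\in X}P$ (with $k(\emptyset)=R$); $kh_Y(S)=k(h_Y(S))$ and $kh_Y(a)=k(h_Y(a))$. For an ideal $I$ of $R$, $\mathcal{H}_Y(I)=\{h_Y(S): S\subseteq I\text{ finite}\}$. *)

theory Defs
  imports "HOL-Algebra.Ideal"
begin

definition Spec :: "('a, 'm) ring_scheme \<Rightarrow> 'a set set"
  where "Spec R = {P. primeideal P R}"

definition hY :: "'a set set \<Rightarrow> 'a set \<Rightarrow> 'a set set"
  where "hY Y S = {P \<in> Y. S \<subseteq> P}"

text \<open>The intersection of a family of subsets of the ring, taken inside the ring, so that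
  the empty family gives \<open>carrier R\<close> and not the whole type.\<close>

definition k_of :: "('a, 'm) ring_scheme \<Rightarrow> 'a set set \<Rightarrow> 'a set"
  where "k_of R X = carrier R \<inter> \<Inter> X"

definition khY :: "('a, 'm) ring_scheme \<Rightarrow> 'a set set \<Rightarrow> 'a set \<Rightarrow> 'a set"
  where "khY R Y S = k_of R (hY Y S)"

definition HY :: "'a set set \<Rightarrow> 'a set \<Rightarrow> 'a set set set"
  where "HY Y I = {hY Y S |S. finite S \<and> S \<subseteq> I}"

definition all_equivalent :: "bool list \<Rightarrow> bool"
  where "all_equivalent ps \<longleftrightarrow> (\<forall>p \<in> set ps. \<forall>q \<in> set ps. p \<longleftrightarrow> q)"

end

theory Submission
  imports Defs
begin

text \<open>All conditions follow from (k), and all imply (f), by instantiation, since \<open>hY Y F \<subseteq> hY Y S\<close>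
  means \<open>S \<subseteq> khY R Y F\<close>. To get (k) from (f), let \<open>hY Y F \<subseteq> hY Y {a}\<close>. As the members of \<open>Y\<close> are
  prime, \<open>hY Y {x \<otimes> a |x. x \<in> F} = hY Y F \<union> hY Y {a} = hY Y {a}\<close>, and all \<open>x \<otimes> a\<close> with
  \<open>x \<in> F\<close> lie in \<open>I\<close>.\<close>

lemma subset_khY_iff:
  assumes "S \<subseteq> carrier R"
  shows "S \<subseteq> khY R Y F \<longleftrightarrow> hY Y F \<subseteq> hY Y S"
  using assms by (auto simp: khY_def k_of_def hY_def)

text \<open>From left to right, \<open>S \<subseteq> khY R Y S\<close> because \<open>S\<close> lies
  in the carrier; from right to left, \<open>k_of R\<close> reverses inclusion.\<close>

lemma khY_subset_iff:
  assumes "S \<subseteq> carrier R"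
  shows "khY R Y S \<subseteq> khY R Y F \<longleftrightarrow> hY Y F \<subseteq> hY Y S"
  using assms by (auto simp: khY_def k_of_def hY_def)

text \<open>The alternative given by primeness is uniform in \<open>x\<close>: if
  \<open>a \<notin> P\<close>, every \<open>x \<in> F\<close> must lie in \<open>P\<close>. For
  empty \<open>F\<close> both sides are \<open>Y\<close>.\<close>

lemma hY_image_mult:
  assumes "Y \<subseteq> Spec R" and "F \<subseteq> carrier R" and "a \<in> carrier R"
  shows "hY Y ((\<lambda>x. x \<otimes>\<^bsub>R\<^esub> a) ` F) = hY Y F \<union> hY Y {a}"
proof -
  have "x \<otimes>\<^bsub>R\<^esub> a \<in> P \<longleftrightarrow> x \<in> P \<or> a \<in> P" if "P \<in> Y" "x \<in> F" for P x
  proof -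
    interpret primeideal P R
      using that assms(1) by (auto simp: Spec_def)
    show ?thesis
      using that assms(2,3) I_prime I_l_closed I_r_closed by blast
  qed
  then show ?thesis
    by (auto simp: hY_def)
qed

text \<open>This is the step from (f), the assumption \<open>closed\<close>, to (k).
  \<open>closed\<close> is applied to the set of products, which is finite because \<open>F\<close>
  is.\<close>

lemma khY_subset_ideal:
  assumes "Y \<subseteq> Spec R" and "ideal I R" and "finite F" and "F \<subseteq> I"
    and closed: "\<And>G a. finite G \<Longrightarrow> G \<subseteq> I \<Longrightarrow> a \<in> carrier R \<Longrightarrow> hY Y G = hY Y {a} \<Longrightarrow> a \<in> I"
  shows "khY R Y F \<subseteq> I"
proof
  fix a assume a: "a \<in> khY R Y F"
  then have aR: "a \<in> carrier R"
    by (simp add: khY_def k_of_def)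
  interpret ideal I R by fact
  have "F \<subseteq> carrier R"
    using assms(4) a_subset by blast
  moreover have "hY Y F \<subseteq> hY Y {a}"
    using a aR subset_khY_iff[of "{a}" R Y F] by simp
  ultimately have "hY Y ((\<lambda>x. x \<otimes>\<^bsub>R\<^esub> a) ` F) = hY Y {a}"
    using hY_image_mult[OF assms(1) _ aR] by blast
  moreover have "(\<lambda>x. x \<otimes>\<^bsub>R\<^esub> a) ` F \<subseteq> I"
    using assms(4) aR I_r_closed by blast
  ultimately show "a \<in> I"
    using closed aR assms(3) by blast
qed

text \<open>A hub \<open>q\<close> replaces a cycle of implications. With \<open>list_all\<close>,
  an explicit list unfolds into a conjunction.\<close>

lemma all_equivalentI:
  assumes "list_all (\<lambda>p. p \<longrightarrow> q) ps" and "q \<Longrightarrow> list_all (\<lambda>p. p) ps"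
  shows "all_equivalent ps"
  using assms unfolding all_equivalent_def list_all_iff by blast

theorem proposition3p4:
  fixes R :: "('a, 'm) ring_scheme" and Y :: "'a set set" and I :: "'a set"
  assumes "cring R" and "Y \<subseteq> Spec R" and "ideal I R"
  shows "all_equivalent
    [\<forall>F S. finite F \<and> F \<subseteq> I \<and> S \<subseteq> carrier R \<longrightarrow>
        hY Y F = hY Y S \<longrightarrow> S \<subseteq> I,
     \<forall>F G. finite F \<and> F \<subseteq> I \<and> finite G \<and> G \<subseteq> carrier R \<longrightarrow>
        hY Y F = hY Y G \<longrightarrow> G \<subseteq> I,
     \<forall>F G. finite F \<and> F \<subseteq> I \<and> finite G \<and> G \<subseteq> carrier R \<longrightarrow>
        hY Y F \<subseteq> hY Y G \<longrightarrow> G \<subseteq> I,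
     \<forall>a \<in> carrier R. hY Y {a} \<in> HY Y I \<longrightarrow> a \<in> I,
     \<forall>F. finite F \<and> F \<subseteq> carrier R \<longrightarrow> hY Y F \<in> HY Y I \<longrightarrow> F \<subseteq> I,
     \<forall>F. finite F \<and> F \<subseteq> I \<longrightarrow>
        (\<forall>a \<in> carrier R. hY Y F = hY Y {a} \<longrightarrow> a \<in> I),
     \<forall>F. finite F \<and> F \<subseteq> I \<longrightarrow>
        (\<forall>a \<in> carrier R. hY Y F \<subseteq> hY Y {a} \<longrightarrow> a \<in> I),
     \<forall>F. finite F \<and> F \<subseteq> I \<longrightarrow> khY R Y F \<subseteq> I,
     \<forall>F. finite F \<and> F \<subseteq> I \<longrightarrow>
        (\<forall>a \<in> carrier R. khY R Y {a} = khY R Y F \<longrightarrow> a \<in> I),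
     \<forall>F. finite F \<and> F \<subseteq> I \<longrightarrow>
        (\<forall>a \<in> carrier R. khY R Y {a} \<subseteq> khY R Y F \<longrightarrow> a \<in> I),
     \<forall>F S. finite F \<and> F \<subseteq> I \<and> S \<subseteq> carrier R \<longrightarrow>
        khY R Y S = khY R Y F \<longrightarrow> S \<subseteq> I,
     \<forall>F S. finite F \<and> F \<subseteq> I \<and> S \<subseteq> carrier R \<longrightarrow>
        khY R Y S \<subseteq> khY R Y F \<longrightarrow> S \<subseteq> I ]"
  (is "all_equivalent ?ps")
proof -
  let ?f = "\<forall>F. finite F \<and> F \<subseteq> I \<longrightarrow> (\<forall>a \<in> carrier R. hY Y F = hY Y {a} \<longrightarrow> a \<in> I)"
  \<comment> \<open>\<open>S\<close> is \<open>{a}\<close>, kept abstract so that first-order proof search does not take \<open>insert\<close> apart\<close>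
  have witness: "\<exists>S. finite S \<and> S \<subseteq> carrier R \<and> (S \<subseteq> I \<longrightarrow> a \<in> I) \<and> a \<in> khY R Y F \<and>
      hY Y F = hY Y S \<and> hY Y F \<subseteq> hY Y S \<and> hY Y S \<in> HY Y I \<and> hY Y {a} \<in> HY Y I \<and>
      khY R Y S = khY R Y F \<and> khY R Y S \<subseteq> khY R Y F \<and>
      khY R Y {a} = khY R Y F \<and> khY R Y {a} \<subseteq> khY R Y F \<and> hY Y F \<subseteq> hY Y {a}"
    if "finite F" "F \<subseteq> I" "a \<in> carrier R" "hY Y F = hY Y {a}" for F a
    \<comment> \<open>\<open>F\<close> itself witnesses membership in \<open>HY Y I\<close>, and
      \<open>khY\<close> depends on its set only through \<open>hY\<close>.\<close>
    using that subset_khY_iff[of "{a}" R Y F] by (intro exI[of _ "{a}"]) (auto simp: HY_def khY_def)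
  show ?thesis
  proof (rule all_equivalentI[where q = ?f])
    show "list_all (\<lambda>p. p \<longrightarrow> ?f) ?ps"
      by (simp only: list.pred_inject simp_thms)
        \<comment> \<open>The premises of (f) fix \<open>F\<close> and \<open>a\<close>; each
          condition is then applied at \<open>S\<close> or \<open>a\<close>, and
          \<open>subsetD\<close> serves (k).\<close>
        (intro conjI; (intro impI allI ballI, elim conjE, frule (3) witness, elim exE conjE, meson subsetD))
    assume f: ?f
    have khY: "khY R Y F \<subseteq> I" if "finite F" "F \<subseteq> I" for F
      using khY_subset_ideal[OF assms(2,3) that] f by blast
    \<comment> \<open>Here \<open>S \<subseteq> khY R Y F \<subseteq> I\<close>.\<close>
    have le: "S \<subseteq> I" if "finite F" "F \<subseteq> I" "S \<subseteq> carrier R" "hY Y F \<subseteq> hY Y S" for F S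
      using khY[OF that(1,2)] subset_khY_iff[OF that(3), of Y F] that(4) by blast
    have kle: "S \<subseteq> I" if "finite F" "F \<subseteq> I" "S \<subseteq> carrier R" "khY R Y S \<subseteq> khY R Y F" for F S
      using le[OF that(1-3)] khY_subset_iff[OF that(3), of Y F] that(4) by blast
    have mem: "S \<subseteq> I" if "S \<subseteq> carrier R" "hY Y S \<in> HY Y I" for S
      using le[OF _ _ that(1)] that(2) unfolding HY_def by blast
    \<comment> \<open>Both kinds of equality are oriented so that \<open>equalityD1\<close> weakens
      them to the inclusion required.\<close>
    note sets = le le[OF _ _ _ equalityD1] kle kle[OF _ _ _ equalityD1] mem
    \<comment> \<open>The conditions on elements are those on sets at
      \<open>S = {a}\<close>.\<close>
    note points = sets[where S = "{a}" for a, unfolded insert_subset, simplified]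
    show "list_all (\<lambda>p. p) ?ps"
      by (simp only: list.pred_inject simp_thms)
        (intro conjI; (intro allI impI ballI, (elim conjE)?, (rule khY sets points; assumption)))
  qed
qed

end
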